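(* Let $q$ be a prime power, let $m,n\ge 1$ be integers, and let $k$ be an integer with $0\le k\le \min(m,n)$. For $m\times n$ matrices of rank $k$ over $\mathbb{F}_q$, the average weight per entry is $$\frac{\left(1-\frac{1}{q}\right)\left(1-\frac{1}{q^{k}}\right)}{\left(1-\frac{1}{q^{m}}\right)\left(1-\frac{1}{q^{n}}\right)}.$$
   Context: $\mathbb{F}_q$ is the finite field with $q$ elements. The weight of a matrix $A$ over $\mathbb{F}_q$ is the number of its non-zero entries. A random rank $k$ matrix $A=(a_{ij})$ is chosen uniformly from the set of all $m\times n$ matrices over $\mathbb{F}_q$ of rank $k$. The probability $\mathbf{P}(a_{ij}\neq 0)$ under this uniform distribution (the number of rank $k$ matrices with $a_{ij}\ne 0$ divided by the number of rank $k$ matrices) is the same for all positions $(i,j)$, and this common value is called the average weight per entry; equivalently, it is the expected weight of $A$ divided by $mn$. *)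

theory Defs
  imports
    "HOL-Probability.Probability"
    "HOL-Number_Theory.Prime_Powers"
    "Jordan_Normal_Form.DL_Rank"
begin

definition rank_mats :: "nat \<Rightarrow> nat \<Rightarrow> nat \<Rightarrow> 'a::field mat set" where
  "rank_mats m n k = {A \<in> carrier_mat m n. vec_space.rank m A = k}"

(* pmf_of_set is meaningful only for finite nonempty sets; over a finite field this set is finite,
   and it is nonempty exactly when k \<le> min m n. *)
definition random_rank_mat :: "nat \<Rightarrow> nat \<Rightarrow> nat \<Rightarrow> 'a::{field,finite} mat pmf" where
  "random_rank_mat m n k = pmf_of_set (rank_mats m n k)"

definition mat_weight :: "'a::zero mat \<Rightarrow> nat" where
  "mat_weight A = card {(i, j). i < dim_row A \<and> j < dim_col A \<and> A $$ (i, j) \<noteq> 0}"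

(* The parameter p is the distribution of a random m x n matrix. *)
definition average_weight_per_entry :: "nat \<Rightarrow> nat \<Rightarrow> 'a::zero mat pmf \<Rightarrow> real" where
  "average_weight_per_entry m n p =
     measure_pmf.expectation p (\<lambda>A. real (mat_weight A)) / (real m * real n)"

end

theory Submission
  imports Defs "Berlekamp_Zassenhaus.Berlekamp_Type_Based"
begin

text \<open>
  Fix a position \<open>(i, j)\<close>. The entry of \<open>A\<close> there is \<open>u \<bullet> (A *\<^sub>v v)\<close> for the unit vectors \<open>u\<close>, \<open>v\<close> of
  index \<open>i\<close>, \<open>j\<close>. The point of the proof is that the probability of \<open>u \<bullet> (A *\<^sub>v v) \<noteq> 0\<close>, for \<open>A\<close>
  uniform of rank \<open>k\<close>, is the same for all non-zero \<open>u\<close> and \<open>v\<close>: multiplication by invertible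
  matrices on both sides permutes the matrices of rank \<open>k\<close>, and the invertible matrices act
  transitively on non-zero vectors (\<open>card_bilinear_nonzero_eq_entry\<close>).

  So one may average over all non-zero \<open>u\<close> and \<open>v\<close> as well, and then the matrix can be held fixed
  instead. For a single \<open>A\<close> of rank \<open>k\<close> the count is immediate (\<open>card_bilinear_nonzero\<close>): the kernel
  has \<open>q ^ (n - k)\<close> elements, which leaves \<open>q ^ n - q ^ (n - k)\<close> choices of \<open>v\<close> with \<open>A *\<^sub>v v \<noteq> 0\<close>, and
  for each of them \<open>A *\<^sub>v v\<close> is orthogonal to exactly one \<open>q\<close>-th of all \<open>u\<close>. Dividing by the
  \<open>(q ^ m - 1) * (q ^ n - 1)\<close> pairs of non-zero vectors gives the probability. The average weight is then a matter of linearity of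
  expectation.

  The rank enters only through the size of the column space: it has \<open>q ^ k\<close> elements exactly if
  the rank is \<open>k\<close> (\<open>card_mult_mat_vec_image\<close>). This makes invariance of the rank under invertible
  factors a statement about cardinalities of images.
\<close>

\<comment> \<open>Below, the dot and dollar signs denote the scalar product and the entries of
  carrier-based vectors.\<close>
unbundle no inner_syntax
unbundle no vec_syntax

section \<open>Rank and cardinality\<close>

text \<open>
  All non-empty fibres of a homomorphism are translates of its kernel. The only trace of linearity in
  the hypothesis is that \<open>f\<close> identifies two vectors exactly if it kills their difference; in
  this form the lemma applies both to matrices and to scalar products.
\<close>
lemma card_kernel_times_card_image:
  fixes f :: "'a::{field,finite} vec \<Rightarrow> 'b"
  assumes f: "\<And>x y. x \<in> carrier_vec n \<Longrightarrow> y \<in> carrier_vec n \<Longrightarrow> f x = f y \<longleftrightarrow> f (x - y) = z"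
  shows "card {x \<in> carrier_vec n. f x = z} * card (f ` carrier_vec n) = CARD('a) ^ n"
proof -
  let ?V = "carrier_vec n :: 'a vec set"
  let ?K = "{x \<in> ?V. f x = z}"
  have fibre: "card {x \<in> ?V. f x = c} = card ?K" if c: "c \<in> f ` ?V" for c
  proof -
    obtain y where y: "y \<in> ?V" "c = f y" using c by auto
    have "bij_betw (\<lambda>x. x - y) {x \<in> ?V. f x = c} ?K"
    proof (rule bij_betw_byWitness[where f' = "\<lambda>x. x + y"])
      show "\<forall>x\<in>{x \<in> ?V. f x = c}. x - y + y = x" using y by auto
      show "\<forall>x\<in>?K. x + y - y = x" using y by auto
      show "(\<lambda>x. x - y) ` {x \<in> ?V. f x = c} \<subseteq> ?K" using y f by auto
      show "(\<lambda>x. x + y) ` ?K \<subseteq> {x \<in> ?V. f x = c}"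
      proof clarsimp
        fix x assume x: "x \<in> ?V" "z = f x"
        have "x + y - y = x" using x y by auto
        then show "x + y \<in> ?V \<and> f (x + y) = c" using f[of "x + y" y] x y by auto
      qed
    qed
    then show ?thesis by (rule bij_betw_same_card)
  qed
  have "CARD('a) ^ n = (\<Sum>x\<in>?V. 1)" by (simp add: card_carrier_vec)
  also have "\<dots> = (\<Sum>c\<in>f ` ?V. \<Sum>x\<in>{x \<in> ?V. f x = c}. 1)"
    by (rule sum.image_gen) simp
  also have "\<dots> = (\<Sum>c\<in>f ` ?V. card ?K)" using fibre by simp
  finally show ?thesis by (simp add: mult.commute)
qed

text \<open>A non-zero \<open>w\<close> makes \<open>u \<mapsto> u \<bullet> w\<close> surjective onto the field, so all values are equally likely.\<close>
lemma card_non_orthogonal: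
  fixes w :: "'a::{field,finite} vec"
  assumes w: "w \<in> carrier_vec m" "w \<noteq> 0\<^sub>v m"
  shows "real (card {u \<in> carrier_vec m. u \<bullet> w \<noteq> 0})
    = real CARD('a) ^ m * (1 - 1 / real CARD('a))"
proof -
  let ?V = "carrier_vec m :: 'a vec set"
  obtain l where l: "l < m" "w $ l \<noteq> 0"
    using w by (metis carrier_vecD eq_vecI index_zero_vec)
  have "(\<lambda>u. u \<bullet> w) ` ?V = UNIV"
  proof -
    have "c = ((c / w $ l) \<cdot>\<^sub>v unit_vec m l) \<bullet> w" for c
      using w l by simp
    then show ?thesis by (auto intro!: image_eqI)
  qed
  moreover have "card {u \<in> ?V. u \<bullet> w = 0} * card ((\<lambda>u. u \<bullet> w) ` ?V) = CARD('a) ^ m"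
    by (rule card_kernel_times_card_image) (use w in \<open>simp add: minus_scalar_prod_distrib\<close>)
  ultimately have K: "card {u \<in> ?V. u \<bullet> w = 0} * CARD('a) = CARD('a) ^ m" by simp
  have "{u \<in> ?V. u \<bullet> w \<noteq> 0} = ?V - {u \<in> ?V. u \<bullet> w = 0}" by auto
  then have "real (card {u \<in> ?V. u \<bullet> w \<noteq> 0}) = real (card ?V) - real (card {u \<in> ?V. u \<bullet> w = 0})"
    by (simp add: card_Diff_subset card_mono of_nat_diff)
  moreover have "real (card {u \<in> ?V. u \<bullet> w = 0}) = real CARD('a) ^ m / real CARD('a)"
    using arg_cong[OF K, of real] by (simp add: field_simps)
  ultimately show ?thesis by (simp add: card_carrier_vec algebra_simps)
qed

lemma card_mat_kernel_times_card_image: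
  fixes A :: "'a::{field,finite} mat"
  assumes A: "A \<in> carrier_mat m n"
  shows "card {x \<in> carrier_vec n. A *\<^sub>v x = 0\<^sub>v m} * card ((*\<^sub>v) A ` carrier_vec n) = CARD('a) ^ n"
proof (rule card_kernel_times_card_image)
  fix x y :: "'a vec" assume xy: "x \<in> carrier_vec n" "y \<in> carrier_vec n"
  have "A *\<^sub>v x - A *\<^sub>v y = 0\<^sub>v m \<longleftrightarrow> A *\<^sub>v x = A *\<^sub>v y"
    using xy A by (auto simp: vec_eq_iff)
  then show "A *\<^sub>v x = A *\<^sub>v y \<longleftrightarrow> A *\<^sub>v (x - y) = 0\<^sub>v m"
    using mult_minus_distrib_mat_vec[OF A xy] by auto
qed

text \<open>
  A maximal independent set of columns spans the column space, and the matrix \<open>B\<close> of these columns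
  has trivial kernel; so \<open>B\<close> maps the coefficient vectors bijectively onto the column space.
\<close>
lemma card_mult_mat_vec_image:
  fixes A :: "'a::{field,finite} mat"
  assumes A: "A \<in> carrier_mat m n"
  shows "card ((*\<^sub>v) A ` carrier_vec n) = CARD('a) ^ vec_space.rank m A"
proof -
  interpret vec_space "TYPE('a)" m .
  have img: "(*\<^sub>v) B ` carrier_vec nc = span (set (cols B))" if "B \<in> carrier_mat m nc" for B nc
    using col_space_eq[OF that] that unfolding col_space_def by auto
  have colsA: "set (cols A) \<subseteq> carrier_vec m" using A cols_dim by blast
  obtain S where S: "maximal S (\<lambda>T. T \<subseteq> set (cols A) \<and> lin_indpt T)"
    using maximal_exists[of "(\<lambda>T. T \<subseteq> set (cols A) \<and> lin_indpt T)" "card (set (cols A))" "{}"]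
    by (meson List.finite_set card_mono empty_iff empty_subsetI finite_lin_indpt2 rev_finite_subset)
  have Sc: "S \<subseteq> set (cols A)" "lin_indpt S" using S by (auto simp: maximal_def)
  have SV: "S \<subseteq> carrier_vec m" using Sc colsA by auto
  have finS: "finite S" using Sc finite_subset by blast
  have spanS: "span S = span (set (cols A))"
  proof
    show "span S \<subseteq> span (set (cols A))" using Sc span_is_monotone by auto
    have "s \<in> span S" if s: "s \<in> set (cols A)" for s
    proof (rule ccontr)
      assume ns: "s \<notin> span S"
      then have "s \<notin> S" using SV span_mem by auto
      moreover have "lin_indpt (S \<union> {s})"
        using lin_dep_iff_in_span[of S s] ns Sc SV s colsA \<open>s \<notin> S\<close> by auto
      ultimately show False using S s Sc unfolding maximal_def by blast
    qed
    then show "span (set (cols A)) \<subseteq> span S"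
      using span_is_subset[OF subsetI span_is_submodule] SV by auto
  qed
  obtain ls where ls: "set ls = S" "distinct ls" using finite_distinct_list[OF finS] by auto
  define B where "B = mat_of_cols m ls"
  have B: "B \<in> carrier_mat m (card S)" using ls distinct_card unfolding B_def by fastforce
  have colsB: "cols B = ls" using ls SV by (simp add: B_def)
  have ker: "{x \<in> carrier_vec (card S). B *\<^sub>v x = 0\<^sub>v m} = {0\<^sub>v (card S)}"
    using lin_depI[OF B] Sc(2) ls B unfolding colsB by auto
  have "card {x \<in> carrier_vec (card S). B *\<^sub>v x = 0\<^sub>v m} * card ((*\<^sub>v) B ` carrier_vec (card S))
      = CARD('a) ^ card S"
    by (rule card_mat_kernel_times_card_image[OF B])
  then have "card (span S) = CARD('a) ^ card S"
    unfolding ker img[OF B] colsB ls(1) by simp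
  then show ?thesis using img[OF A] spanS rank_card_indpt[OF A S] by simp
qed

lemma card_non_kernel:
  fixes A :: "'a::{field,finite} mat"
  assumes A: "A \<in> carrier_mat m n"
  shows "real (card {v \<in> carrier_vec n. A *\<^sub>v v \<noteq> 0\<^sub>v m})
    = real CARD('a) ^ n * (1 - 1 / real CARD('a) ^ vec_space.rank m A)"
proof -
  let ?V = "carrier_vec n :: 'a vec set"
  let ?K = "{v \<in> ?V. A *\<^sub>v v = 0\<^sub>v m}"
  have "card ?K * card ((*\<^sub>v) A ` ?V) = CARD('a) ^ n"
    by (rule card_mat_kernel_times_card_image[OF A])
  then have K: "card ?K * CARD('a) ^ vec_space.rank m A = CARD('a) ^ n"
    unfolding card_mult_mat_vec_image[OF A] .
  have "{v \<in> ?V. A *\<^sub>v v \<noteq> 0\<^sub>v m} = ?V - ?K" by auto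
  then have "real (card {v \<in> ?V. A *\<^sub>v v \<noteq> 0\<^sub>v m}) = real (card ?V) - real (card ?K)"
    by (simp add: card_Diff_subset card_mono of_nat_diff)
  moreover have "real (card ?K) = real CARD('a) ^ n / real CARD('a) ^ vec_space.rank m A"
    using arg_cong[OF K, of real] by (simp add: field_simps)
  ultimately show ?thesis by (simp add: card_carrier_vec algebra_simps)
qed

text \<open>
  The vectors \<open>v\<close> outside the kernel are counted first, then the \<open>u\<close> not orthogonal to \<open>A *\<^sub>v v\<close>.
\<close>
lemma card_bilinear_nonzero:
  fixes A :: "'a::{field,finite} mat"
  assumes A: "A \<in> carrier_mat m n"
  shows "real (card {(v, u). v \<in> carrier_vec n \<and> u \<in> carrier_vec m \<and> u \<bullet> (A *\<^sub>v v) \<noteq> 0})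
    = real CARD('a) ^ n * (1 - 1 / real CARD('a) ^ vec_space.rank m A)
      * (real CARD('a) ^ m * (1 - 1 / real CARD('a)))"
proof -
  let ?N = "{v \<in> carrier_vec n. A *\<^sub>v v \<noteq> 0\<^sub>v m}"
  have "{(v, u). v \<in> carrier_vec n \<and> u \<in> carrier_vec m \<and> u \<bullet> (A *\<^sub>v v) \<noteq> 0}
      = (SIGMA v:?N. {u \<in> carrier_vec m. u \<bullet> (A *\<^sub>v v) \<noteq> 0})"
    by auto
  moreover have "real (card (SIGMA v:?N. {u \<in> carrier_vec m. u \<bullet> (A *\<^sub>v v) \<noteq> 0}))
      = (\<Sum>v\<in>?N. real (card {u \<in> carrier_vec m. u \<bullet> (A *\<^sub>v v) \<noteq> 0}))"
    by (subst card_SigmaI) auto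
  moreover have "\<dots> = (\<Sum>v\<in>?N. real CARD('a) ^ m * (1 - 1 / real CARD('a)))"
    using A by (intro sum.cong refl card_non_orthogonal) auto
  ultimately show ?thesis by (simp add: card_non_kernel[OF A])
qed

section \<open>Symmetries of the set of matrices of fixed rank\<close>

text \<open>
  Transitivity on non-zero vectors. The map \<open>x \<mapsto> x + (f \<bullet> x) \<cdot>\<^sub>v (v - e)\<close>, where \<open>e\<close> is the \<open>j\<close>-th
  unit vector, sends \<open>e\<close> to \<open>v\<close> as soon as \<open>f \<bullet> e = 1\<close>. It multiplies the value of the linear
  form \<open>f\<close> by \<open>f \<bullet> v\<close>, so it is injective if \<open>f \<bullet> v \<noteq> 0\<close>. A form with both properties exists because
  \<open>v\<close> is non-zero.
\<close>
lemma exists_invertible_mat_with_col: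
  fixes v :: "'a::field vec"
  assumes v: "v \<in> carrier_vec n" "v \<noteq> 0\<^sub>v n" and j: "j < n"
  obtains Q Q' where "Q \<in> carrier_mat n n" "Q' \<in> carrier_mat n n"
    "Q * Q' = 1\<^sub>m n" "Q' * Q = 1\<^sub>m n" "col Q j = v"
proof -
  obtain l where l: "l < n" "v $ l \<noteq> 0"
    using v by (metis carrier_vecD eq_vecI index_zero_vec)
  \<comment> \<open>If \<open>v $ j = 0\<close>, the form \<open>x $ j + x $ l\<close> still has value 1 at the \<open>j\<close>-th unit vector, as \<open>l \<noteq> j\<close>.\<close>
  define f :: "'a vec" where
    "f = (if v $ j \<noteq> 0 then unit_vec n j else unit_vec n j + unit_vec n l)"
  have f: "f \<in> carrier_vec n" by (simp add: f_def)
  have fj: "f $ j = 1" using j l by (auto simp: f_def)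
  have fv: "f \<bullet> v \<noteq> 0"
    using j l v by (auto simp: f_def add_scalar_prod_distrib[of _ n])
  define d where "d = v - unit_vec n j"
  have d: "d \<in> carrier_vec n" using v by (simp add: d_def)
  have fd: "f \<bullet> d = f \<bullet> v - 1"
    using f v j fj unfolding d_def by (subst scalar_prod_minus_distrib[of _ n]) auto
  define Q where "Q = mat n n (\<lambda>(a, b). (if a = b then 1 else 0) + d $ a * f $ b)"
  have Q: "Q \<in> carrier_mat n n" by (simp add: Q_def)
  have Qx: "Q *\<^sub>v x = x + (f \<bullet> x) \<cdot>\<^sub>v d" if x: "x \<in> carrier_vec n" for x
  proof
    show "dim_vec (Q *\<^sub>v x) = dim_vec (x + (f \<bullet> x) \<cdot>\<^sub>v d)" using Q d by simp
    fix a assume "a < dim_vec (x + (f \<bullet> x) \<cdot>\<^sub>v d)"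
    then have a: "a < n" using d by simp
    have "(Q *\<^sub>v x) $ a = (\<Sum>b<n. ((if a = b then 1 else 0) + d $ a * f $ b) * x $ b)"
      using a x by (simp add: Q_def scalar_prod_def lessThan_atLeast0)
    also have "\<dots> = (\<Sum>b<n. (if a = b then x $ b else 0)) + d $ a * (\<Sum>b<n. f $ b * x $ b)"
      by (simp add: sum.distrib sum_distrib_left ring_distribs mult.assoc
          if_distrib[of "\<lambda>c. c * _"] cong: if_cong)
    also have "\<dots> = (x + (f \<bullet> x) \<cdot>\<^sub>v d) $ a"
      using a x d by (simp add: scalar_prod_def lessThan_atLeast0)
    finally show "(Q *\<^sub>v x) $ a = (x + (f \<bullet> x) \<cdot>\<^sub>v d) $ a" .
  qed
  have "det Q \<noteq> 0"
  proof
    assume "det Q = 0"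
    then obtain x where x: "x \<in> carrier_vec n" "x \<noteq> 0\<^sub>v n" "Q *\<^sub>v x = 0\<^sub>v n"
      using det_0_iff_vec_prod_zero_field[OF Q] by auto
    have "0 = f \<bullet> (x + (f \<bullet> x) \<cdot>\<^sub>v d)" using x f Qx by simp
    also have "\<dots> = f \<bullet> x + (f \<bullet> x) * (f \<bullet> d)"
      using f x d by (subst scalar_prod_add_distrib[of _ n]) auto
    also have "\<dots> = (f \<bullet> x) * (f \<bullet> v)" by (simp add: fd algebra_simps)
    finally have "f \<bullet> x = 0" using fv by simp
    then have "x = 0\<^sub>v n" using Qx[OF x(1)] x d by auto
    then show False using x by simp
  qed
  from det_non_zero_imp_unit[OF Q this, of "()"]
  obtain Q' where Q': "Q' \<in> carrier_mat n n" "Q * Q' = 1\<^sub>m n" "Q' * Q = 1\<^sub>m n"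
    by (auto simp: Units_def ring_mat_def)
  have "col Q j = v"
    using v j fj by (intro eq_vecI) (auto simp: Q_def d_def)
  then show thesis using that Q Q' by blast
qed

text \<open>
  Since powers of the field size determine their exponents, comparing the sizes of column
  spaces compares ranks.
\<close>
lemma card_field_gt_1: "CARD('a::{field,finite}) > 1"
proof -
  have "card {0 :: 'a, 1} \<le> CARD('a)" by (rule card_mono) simp_all
  then show ?thesis by simp
qed

lemma rank_invariant:
  fixes A :: "'a::{field,finite} mat"
  assumes A: "A \<in> carrier_mat m n"
    and P: "P \<in> carrier_mat m m" "P' \<in> carrier_mat m m" "P' * P = 1\<^sub>m m"
    and Q: "Q \<in> carrier_mat n n" "Q' \<in> carrier_mat n n" "Q * Q' = 1\<^sub>m n"
  shows "vec_space.rank m (P * A * Q) = vec_space.rank m A"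
proof -
  have "(*\<^sub>v) Q ` carrier_vec n = carrier_vec n"
  proof
    show "carrier_vec n \<subseteq> (*\<^sub>v) Q ` carrier_vec n"
    proof
      fix x :: "'a vec" assume "x \<in> carrier_vec n"
      moreover from this have "x = Q *\<^sub>v (Q' *\<^sub>v x)"
        by (subst assoc_mult_mat_vec[symmetric, OF Q(1,2)]) (simp_all add: Q(3))
      ultimately show "x \<in> (*\<^sub>v) Q ` carrier_vec n"
        using Q by (intro image_eqI[where x = "Q' *\<^sub>v x"]) simp_all
    qed
  qed (use Q in auto)
  moreover have "(*\<^sub>v) (P * A * Q) ` carrier_vec n = (*\<^sub>v) P ` (*\<^sub>v) A ` (*\<^sub>v) Q ` carrier_vec n"
  proof -
    have "P * A * Q *\<^sub>v x = P *\<^sub>v (A *\<^sub>v (Q *\<^sub>v x))" if "x \<in> carrier_vec n" for x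
      using A P Q that
      by (simp add: assoc_mult_mat_vec[of "P * A" m n Q n] assoc_mult_mat_vec[of P m m A n]
          del: assoc_mult_mat)
    then show ?thesis by (simp add: image_image cong: image_cong)
  qed
  moreover have "inj_on ((*\<^sub>v) P) ((*\<^sub>v) A ` carrier_vec n)"
  proof (rule inj_on_inverseI)
    fix x assume "x \<in> (*\<^sub>v) A ` carrier_vec n"
    then have "x \<in> carrier_vec m" using A by auto
    then show "P' *\<^sub>v (P *\<^sub>v x) = x" 
      by (subst assoc_mult_mat_vec[symmetric, OF P(2,1)]) (simp_all add: P(3))
  qed
  ultimately have "card ((*\<^sub>v) (P * A * Q) ` carrier_vec n) = card ((*\<^sub>v) A ` carrier_vec n)"
    by (metis card_image)
  moreover have "P * A * Q \<in> carrier_mat m n" using A P Q by simp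
  ultimately have "CARD('a) ^ vec_space.rank m (P * A * Q) = CARD('a) ^ vec_space.rank m A"
    using card_mult_mat_vec_image A by metis
  then show ?thesis using card_field_gt_1[where 'a = 'a] by simp
qed

lemma finite_rank_mats: "finite (rank_mats m n k :: 'a::{field,finite} mat set)"
proof -
  have "carrier_mat m n \<subseteq> mat_of_rows_list n ` {xs :: 'a list list. set xs \<subseteq> {ys. set ys \<subseteq> UNIV \<and> length ys = n} \<and> length xs = m}"
  proof
    fix A :: "'a mat" assume A: "A \<in> carrier_mat m n"
    have eq: "A = mat_of_rows_list n (mat_to_list A)"
      using A by (intro eq_matI) (auto simp: mat_of_rows_list_def mat_to_list_def)
    have "length (mat_to_list A) = m" "\<forall>ys\<in>set (mat_to_list A). length ys = n"
      using A by (auto simp: mat_to_list_def)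
    then show "A \<in> mat_of_rows_list n ` {xs. set xs \<subseteq> {ys. set ys \<subseteq> UNIV \<and> length ys = n} \<and> length xs = m}"
      by (intro image_eqI[where x = "mat_to_list A"] eq) auto
  qed
  moreover have "finite {xs :: 'a list list. set xs \<subseteq> {ys. set ys \<subseteq> UNIV \<and> length ys = n} \<and> length xs = m}"
    by (intro finite_lists_length_eq) simp
  ultimately have "finite (carrier_mat m n :: 'a mat set)" by (rule finite_surj[rotated])
  then show ?thesis by (simp add: rank_mats_def)
qed

text \<open>The witness has \<open>k\<close> ones on the diagonal; its image is a copy of \<open>carrier_vec k\<close> padded with zeros.\<close>
lemma rank_mats_nonempty:
  assumes "k \<le> min m n"
  shows "(rank_mats m n k :: 'a::{field,finite} mat set) \<noteq> {}"
proof -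
  define D :: "'a mat" where "D = mat m n (\<lambda>(a, b). if a = b \<and> a < k then 1 else 0)"
  define pad :: "'a vec \<Rightarrow> 'a vec" where "pad = (\<lambda>w. vec m (\<lambda>a. if a < k then w $ a else 0))"
  have D: "D \<in> carrier_mat m n" by (simp add: D_def)
  have Dx: "D *\<^sub>v x = pad x" if x: "x \<in> carrier_vec n" for x
  proof
    show "dim_vec (D *\<^sub>v x) = dim_vec (pad x)" using D by (simp add: pad_def)
    fix a assume "a < dim_vec (pad x)"
    then have a: "a < m" by (simp add: pad_def)
    have "(D *\<^sub>v x) $ a = (\<Sum>b<n. (if a = b \<and> a < k then 1 else 0) * x $ b)"
      using a x by (simp add: D_def scalar_prod_def lessThan_atLeast0)
    also have "\<dots> = (\<Sum>b<n. if b = a then (if a < k then x $ a else 0) else 0)"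
      by (rule sum.cong) auto
    also have "\<dots> = pad x $ a" using a assms by (simp add: pad_def)
    finally show "(D *\<^sub>v x) $ a = pad x $ a" .
  qed
  have "(*\<^sub>v) D ` carrier_vec n = pad ` carrier_vec k"
  proof (intro equalityI subsetI)
    fix y assume "y \<in> (*\<^sub>v) D ` carrier_vec n"
    then obtain x where "x \<in> carrier_vec n" "y = pad x" using Dx by auto
    then have "y = pad (vec k (($) x))" by (auto simp: pad_def)
    then show "y \<in> pad ` carrier_vec k" by (rule image_eqI) simp
  next
    fix y assume "y \<in> pad ` carrier_vec k"
    then obtain w where w: "y = pad w" by auto
    have "pad w = D *\<^sub>v vec n (\<lambda>a. if a < k then w $ a else 0)"
      using assms by (subst Dx) (auto simp: pad_def)
    then show "y \<in> (*\<^sub>v) D ` carrier_vec n" using w by auto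
  qed
  moreover have "inj_on pad (carrier_vec k)"
  proof (rule inj_onI)
    fix x y assume xy: "x \<in> carrier_vec k" "y \<in> carrier_vec k" "pad x = pad y"
    have "x $ a = y $ a" if "a < k" for a
      using arg_cong[OF xy(3), of "\<lambda>w. w $ a"] that assms by (simp add: pad_def)
    then show "x = y" using xy by (intro eq_vecI) auto
  qed
  ultimately have "CARD('a) ^ vec_space.rank m D = CARD('a) ^ k"
    by (simp flip: card_mult_mat_vec_image[OF D] add: card_image card_carrier_vec)
  then have "vec_space.rank m D = k" using card_field_gt_1[where 'a = 'a] by simp
  then show ?thesis using D by (auto simp: rank_mats_def)
qed

text \<open>
  If \<open>P\<close> and \<open>Q\<close> are invertible with \<open>u\<close> as column \<open>i\<close> of \<open>P\<close> and \<open>v\<close> as column \<open>j\<close> of \<open>Q\<close>, then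
  \<open>A \<mapsto> P\<^sup>T * A * Q\<close> permutes the matrices of rank \<open>k\<close> and turns \<open>u \<bullet> (A *\<^sub>v v)\<close> into the
  \<open>(i, j)\<close> entry.
\<close>
lemma card_bilinear_nonzero_eq_entry:
  fixes u v :: "'a::{field,finite} vec"
  assumes u: "u \<in> carrier_vec m" "u \<noteq> 0\<^sub>v m" and v: "v \<in> carrier_vec n" "v \<noteq> 0\<^sub>v n"
    and ij: "i < m" "j < n"
  shows "card {A \<in> rank_mats m n k. u \<bullet> (A *\<^sub>v v) \<noteq> 0} = card {A \<in> rank_mats m n k. A $$ (i, j) \<noteq> (0::'a)}"
proof -
  let ?R = "rank_mats m n k :: 'a mat set"
  obtain P P' where P: "P \<in> carrier_mat m m" "P' \<in> carrier_mat m m"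
    "P * P' = 1\<^sub>m m" "P' * P = 1\<^sub>m m" "col P i = u"
    using exists_invertible_mat_with_col[OF u ij(1)] .
  obtain Q Q' where Q: "Q \<in> carrier_mat n n" "Q' \<in> carrier_mat n n"
    "Q * Q' = 1\<^sub>m n" "Q' * Q = 1\<^sub>m n" "col Q j = v"
    using exists_invertible_mat_with_col[OF v ij(2)] .
  have PT: "P\<^sup>T \<in> carrier_mat m m" "P'\<^sup>T \<in> carrier_mat m m"
    using P by simp_all
  have "P'\<^sup>T * P\<^sup>T = (P * P')\<^sup>T" "P\<^sup>T * P'\<^sup>T = (P' * P)\<^sup>T"
    by (rule transpose_mult[OF P(1,2), symmetric], rule transpose_mult[OF P(2,1), symmetric])
  then have PT': "P'\<^sup>T * P\<^sup>T = 1\<^sub>m m" "P\<^sup>T * P'\<^sup>T = 1\<^sub>m m"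
    unfolding P(3,4) by simp_all
  define \<phi> where "\<phi> A = P\<^sup>T * A * Q" for A
  define \<psi> where "\<psi> A = P'\<^sup>T * A * Q'" for A
  have RC: "A \<in> carrier_mat m n" if "A \<in> ?R" for A
    using that by (simp add: rank_mats_def)
  have transform_in: "X * A * Y \<in> ?R"
    if "A \<in> ?R" "X \<in> carrier_mat m m" "X' \<in> carrier_mat m m" "X' * X = 1\<^sub>m m"
      "Y \<in> carrier_mat n n" "Y' \<in> carrier_mat n n" "Y * Y' = 1\<^sub>m n" for A X X' Y Y'
  proof -
    have "X * A * Y \<in> carrier_mat m n"
      by (rule mult_carrier_mat[OF mult_carrier_mat[OF that(2) RC[OF that(1)]] that(5)])
    then show ?thesis
      using rank_invariant[OF RC[OF that(1)] that(2-7)] that(1) unfolding rank_mats_def by simp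
  qed
  have \<phi>R: "\<phi> A \<in> ?R" if "A \<in> ?R" for A
    unfolding \<phi>_def by (rule transform_in[OF that PT PT'(1) Q(1-3)])
  have \<psi>R: "\<psi> A \<in> ?R" if "A \<in> ?R" for A
    unfolding \<psi>_def by (rule transform_in[OF that PT(2,1) PT'(2) Q(2,1,4)])
  have cancel: "X' * (X * A * Y) * Y' = A"
    if "A \<in> ?R" "X \<in> carrier_mat m m" "X' \<in> carrier_mat m m" "X' * X = 1\<^sub>m m"
      "Y \<in> carrier_mat n n" "Y' \<in> carrier_mat n n" "Y * Y' = 1\<^sub>m n" for A X X' Y Y'
  proof -
    note A = RC[OF that(1)]
    note XA = mult_carrier_mat[OF that(2) A]
    have "X' * (X * A * Y) * Y' = X' * (X * A * (Y * Y'))"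
      unfolding assoc_mult_mat[OF that(3) mult_carrier_mat[OF XA that(5)] that(6)]
        assoc_mult_mat[OF XA that(5,6)] ..
    also have "\<dots> = X' * X * A"
      unfolding that(7) right_mult_one_mat[OF XA] assoc_mult_mat[OF that(3,2) A] ..
    also have "\<dots> = A" unfolding that(4) by (rule left_mult_one_mat[OF A])
    finally show ?thesis .
  qed
  have inv: "\<psi> (\<phi> A) = A" "\<phi> (\<psi> A) = A" if "A \<in> ?R" for A
    unfolding \<phi>_def \<psi>_def
    by (rule cancel[OF that PT PT'(1) Q(1-3)], rule cancel[OF that PT(2,1) PT'(2) Q(2,1,4)])
  have entry: "\<phi> A $$ (i, j) = u \<bullet> (A *\<^sub>v v)" if "A \<in> ?R" for A
  proof -
    note A = RC[OF that]
    have "\<phi> A $$ (i, j) = (P\<^sup>T * (A * Q)) $$ (i, j)"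
      unfolding \<phi>_def assoc_mult_mat[OF PT(1) A Q(1)] ..
    also have "\<dots> = row P\<^sup>T i \<bullet> col (A * Q) j" using A P Q ij by simp
    also have "\<dots> = u \<bullet> (A *\<^sub>v v)" using A P Q ij by (simp add: col_mult2[OF A Q(1) ij(2)])
    finally show ?thesis .
  qed
  have "bij_betw \<phi> {A \<in> ?R. u \<bullet> (A *\<^sub>v v) \<noteq> 0} {A \<in> ?R. A $$ (i, j) \<noteq> 0}"
  proof (rule bij_betw_byWitness[where f' = \<psi>])
    show "\<psi> ` {A \<in> ?R. A $$ (i, j) \<noteq> 0} \<subseteq> {A \<in> ?R. u \<bullet> (A *\<^sub>v v) \<noteq> 0}"
    proof safe
      fix A assume A: "A \<in> ?R" "A $$ (i, j) \<noteq> 0"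
      show "\<psi> A \<in> ?R" by (rule \<psi>R[OF A(1)])
      assume "u \<bullet> (\<psi> A *\<^sub>v v) = 0"
      then show False using entry[OF \<psi>R[OF A(1)]] inv(2)[OF A(1)] A(2) by simp
    qed
  qed (use inv \<phi>R entry in auto)
  then show ?thesis by (rule bij_betw_same_card)
qed

section \<open>Counting and averaging\<close>

text \<open>
  Double counting of the triples \<open>(A, v, u)\<close> with \<open>u \<bullet> (A *\<^sub>v v) \<noteq> 0\<close>: for every pair of non-zero
  vectors the number of \<open>A\<close> is the same, and for every \<open>A\<close> the number of pairs is the same.
\<close>
lemma card_entry_nonzero:
  fixes R :: "'a::{field,finite} mat set" and m n k :: nat
  defines "R \<equiv> rank_mats m n k" and "q \<equiv> real CARD('a)"
  assumes ij: "i < m" "j < n"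
  shows "(q ^ m - 1) * (q ^ n - 1) * real (card {A \<in> R. A $$ (i, j) \<noteq> 0})
    = q ^ n * (1 - 1 / q ^ k) * (q ^ m * (1 - 1 / q)) * real (card R)"
proof -
  let ?U = "carrier_vec m - {0\<^sub>v m} :: 'a vec set"
  let ?V = "carrier_vec n - {0\<^sub>v n} :: 'a vec set"
  let ?N = "card {A \<in> R. A $$ (i, j) \<noteq> 0}"
  let ?hit = "\<lambda>A (v, u). u \<bullet> (A *\<^sub>v v) \<noteq> 0"
  have card_nonzero: "real (card (carrier_vec d - {0\<^sub>v d} :: 'a vec set)) = q ^ d - 1" for d
    using card_field_gt_1[where 'a = 'a]
    by (simp add: card_Diff_subset card_carrier_vec q_def of_nat_diff)
  have hits: "{p \<in> ?V \<times> ?U. ?hit A p} = {(v, u). v \<in> carrier_vec n \<and> u \<in> carrier_vec m \<and> u \<bullet> (A *\<^sub>v v) \<noteq> 0}"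
    if "A \<in> R" for A
  proof -
    have "A *\<^sub>v 0\<^sub>v n = 0\<^sub>v m"
      using that by (intro eq_vecI) (auto simp: R_def rank_mats_def)
    moreover have "0\<^sub>v m \<bullet> (A *\<^sub>v v) = 0" if "v \<in> carrier_vec n" for v
      using \<open>A \<in> R\<close> that by (intro scalar_prod_left_zero) (auto simp: R_def rank_mats_def)
    ultimately show ?thesis by auto
  qed
  have total: "(\<Sum>A\<in>R. card {p \<in> ?V \<times> ?U. ?hit A p}) = ?N * card (?V \<times> ?U)"
  proof (rule sum_multicount)
    show "finite R" unfolding R_def by (rule finite_rank_mats)
    show "\<forall>p\<in>?V \<times> ?U. card {A \<in> R. ?hit A p} = ?N"
    proof
      fix p assume "p \<in> ?V \<times> ?U"
      then obtain v u where p: "p = (v, u)" and "v \<in> ?V" "u \<in> ?U" by (rule SigmaE)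
      then show "card {A \<in> R. ?hit A p} = ?N"
        unfolding p R_def prod.case
        by (intro card_bilinear_nonzero_eq_entry ij) simp_all
    qed
  qed simp
  have "real (?N * card (?V \<times> ?U)) = (\<Sum>A\<in>R. real (card {p \<in> ?V \<times> ?U. ?hit A p}))"
    unfolding total[symmetric] by (rule of_nat_sum)
  also have "\<dots> = (\<Sum>A\<in>R. q ^ n * (1 - 1 / q ^ k) * (q ^ m * (1 - 1 / q)))"
  proof (rule sum.cong[OF refl])
    fix A assume A: "A \<in> R"
    then show "real (card {p \<in> ?V \<times> ?U. ?hit A p}) = q ^ n * (1 - 1 / q ^ k) * (q ^ m * (1 - 1 / q))"
      unfolding hits[OF A] q_def by (subst card_bilinear_nonzero) (auto simp: R_def rank_mats_def)
  qed
  also have "\<dots> = real (card R) * (q ^ n * (1 - 1 / q ^ k) * (q ^ m * (1 - 1 / q)))"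
    by (rule sum_constant)
  finally have "real ?N * ((q ^ n - 1) * (q ^ m - 1))
      = real (card R) * (q ^ n * (1 - 1 / q ^ k) * (q ^ m * (1 - 1 / q)))"
    unfolding card_cartesian_product of_nat_mult card_nonzero .
  then show ?thesis by (simp only: mult_ac)
qed

lemma prob_entry_nonzero:
  defines "q \<equiv> real CARD('a::{field,finite})"
  assumes ij: "i < m" "j < n" and k: "k \<le> min m n"
  shows "measure_pmf.prob (random_rank_mat m n k :: 'a mat pmf) {A. A $$ (i, j) \<noteq> 0}
    = (1 - 1 / q) * (1 - 1 / q ^ k) / ((1 - 1 / q ^ m) * (1 - 1 / q ^ n))"
proof -
  let ?R = "rank_mats m n k :: 'a mat set"
  let ?N = "card {A \<in> ?R. A $$ (i, j) \<noteq> 0}"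
  have R: "finite ?R" "?R \<noteq> {}" using finite_rank_mats rank_mats_nonempty[OF k] by auto
  have q: "q > 1" using card_field_gt_1[where 'a = 'a] by (simp add: q_def)
  then have pos: "q ^ m > 1" "q ^ n > 1" using ij by (auto intro!: one_less_power)
  have "measure_pmf.prob (random_rank_mat m n k :: 'a mat pmf) {A. A $$ (i, j) \<noteq> 0}
      = real ?N / real (card ?R)"
    unfolding random_rank_mat_def using R by (simp add: measure_pmf_of_set Int_def)
  also have "\<dots> = q ^ n * (1 - 1 / q ^ k) * (q ^ m * (1 - 1 / q)) / ((q ^ m - 1) * (q ^ n - 1))"
  proof (subst frac_eq_eq)
    show "real (card ?R) \<noteq> 0" using R by simp
    show "(q ^ m - 1) * (q ^ n - 1) \<noteq> 0" using pos by simp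
    show "real ?N * ((q ^ m - 1) * (q ^ n - 1))
        = q ^ n * (1 - 1 / q ^ k) * (q ^ m * (1 - 1 / q)) * real (card ?R)"
      using card_entry_nonzero[OF ij, of k, where 'a = 'a, folded q_def]
      by (simp only: mult.commute)
  qed
  also have "q ^ m - 1 = q ^ m * (1 - 1 / q ^ m)" using q by (simp add: right_diff_distrib)
  also have "q ^ n - 1 = q ^ n * (1 - 1 / q ^ n)" using q by (simp add: right_diff_distrib)
  also have "q ^ n * (1 - 1 / q ^ k) * (q ^ m * (1 - 1 / q))
        / (q ^ m * (1 - 1 / q ^ m) * (q ^ n * (1 - 1 / q ^ n)))
      = (q ^ m * q ^ n) * ((1 - 1 / q) * (1 - 1 / q ^ k))
        / ((q ^ m * q ^ n) * ((1 - 1 / q ^ m) * (1 - 1 / q ^ n)))"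
    by (simp only: mult_ac)
  also have "\<dots> = (1 - 1 / q) * (1 - 1 / q ^ k) / ((1 - 1 / q ^ m) * (1 - 1 / q ^ n))"
    by (rule mult_divide_mult_cancel_left) (use q in simp)
  finally show ?thesis .
qed

lemma mat_weight_eq_sum:
  assumes "A \<in> carrier_mat m n"
  shows "real (mat_weight A) = (\<Sum>i<m. \<Sum>j<n. indicator {A. A $$ (i, j) \<noteq> 0} A)"
proof -
  have "{(i, j). i < dim_row A \<and> j < dim_col A \<and> A $$ (i, j) \<noteq> 0}
      = (SIGMA i:{..<m}. {j \<in> {..<n}. A $$ (i, j) \<noteq> 0})"
    using assms by auto
  then have "real (mat_weight A) = (\<Sum>i<m. real (card {j \<in> {..<n}. A $$ (i, j) \<noteq> 0}))"
    unfolding mat_weight_def by (simp add: card_SigmaI)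
  also have "\<dots> = (\<Sum>i<m. \<Sum>j<n. indicator {A. A $$ (i, j) \<noteq> 0} A)"
    by (intro sum.cong refl) (simp add: indicator_def sum.If_cases Int_def)
  finally show ?thesis .
qed

theorem theorem2p3:
  fixes m n k q :: nat
    and A :: "'a::{field,finite} mat pmf"
  assumes "primepow q"
    and "CARD('a) = q"
    and "m \<ge> 1" and "n \<ge> 1"
    and "k \<le> min m n"
    and "A = random_rank_mat m n k"
  shows "(\<forall>i<m. \<forall>j<n. measure_pmf.prob A {M. M $$ (i, j) \<noteq> 0} =
            (1 - 1 / real q) * (1 - 1 / real q ^ k) /
            ((1 - 1 / real q ^ m) * (1 - 1 / real q ^ n)))
       \<and> average_weight_per_entry m n A =
            (1 - 1 / real q) * (1 - 1 / real q ^ k) /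
            ((1 - 1 / real q ^ m) * (1 - 1 / real q ^ n))"
proof -
  let ?c = "(1 - 1 / real q) * (1 - 1 / real q ^ k) / ((1 - 1 / real q ^ m) * (1 - 1 / real q ^ n))"
  have prob: "measure_pmf.prob A {M. M $$ (i, j) \<noteq> 0} = ?c" if "i < m" "j < n" for i j
    unfolding assms(6) assms(2)[symmetric] by (rule prob_entry_nonzero[OF that assms(5)])
  have "set_pmf A = rank_mats m n k"
    unfolding assms(6) random_rank_mat_def
    by (rule set_pmf_of_set[OF rank_mats_nonempty[OF assms(5)] finite_rank_mats])
  then have fin: "finite (set_pmf A)" and sub: "set_pmf A \<subseteq> carrier_mat m n"
    by (simp_all add: finite_rank_mats) (auto simp: rank_mats_def)
  have "measure_pmf.expectation A (\<lambda>M. real (mat_weight M))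
      = measure_pmf.expectation A (\<lambda>M. \<Sum>i<m. \<Sum>j<n. indicator {M. M $$ (i, j) \<noteq> 0} M)"
    using sub by (intro integral_cong_AE) (auto simp: AE_measure_pmf_iff mat_weight_eq_sum)
  also have "\<dots> = (\<Sum>i<m. \<Sum>j<n. measure_pmf.prob A {M. M $$ (i, j) \<noteq> 0})"
    using fin by (simp add: Bochner_Integration.integral_sum integrable_measure_pmf_finite)
  also have "\<dots> = real m * real n * ?c" using prob by simp
  finally have "average_weight_per_entry m n A = ?c"
    unfolding average_weight_per_entry_def using assms(3,4) by simp
  then show ?thesis using prob by blast
qed

end
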